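(* Let $N\in\mathbb{N}$ be square-free and let $k>1$ be an integer. Then for all $c,d\mid N$, $$\sum_{t\mid N}(-1)^{\omega(t)+\omega(c)}\left(\frac{N\gcd(c,t)}{t}\cdot\frac{\gcd(t,d)}{d}\right)^{2k}=\begin{cases}\displaystyle\prod_{p\mid N}(p^{2k}-1)&\text{if }c=d,\\[1ex]0&\text{if }c\ne d.\end{cases}$$
   Context: All divisors are positive, $p$ runs over primes, and $\omega(m)$ denotes the number of distinct prime divisors of $m$. *)

theory Defs
  imports Complex_Main "HOL-Computational_Algebra.Squarefree"
begin

definition omega :: "nat \<Rightarrow> nat" where
  "omega m = card {p. prime p \<and> p dvd m}"

end

theory Submission
  imports Defs
begin

text \<open>
  Every quantity in the sum is multiplicative over the primes \<open>p\<close> dividing the squarefree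
  number \<open>N\<close>: a divisor \<open>t\<close> of \<open>N\<close> is the product of the primes dividing it, so each of \<open>t\<close>,
  \<open>gcd c t\<close>, \<open>gcd t d\<close>, \<open>d\<close> and the sign is a product over all \<open>p\<close> dividing \<open>N\<close> of a factor that
  only depends on whether \<open>p\<close> divides \<open>t\<close>, \<open>c\<close> and \<open>d\<close>. Since divisors of \<open>N\<close> correspond to
  sets of primes dividing \<open>N\<close>, the sum over \<open>t\<close> is an expanded product of binomials
  (\<open>sum_divisors_squarefree\<close>), namely the product over \<open>p\<close> of
  \<open>(term for p dvd t) + (term for \<not> p dvd t)\<close>. With \<open>q = p ^ (2 * k)\<close> these two terms add up as
  follows:

    \<^item> \<open>p\<close> divides neither \<open>c\<close> nor \<open>d\<close>: \<open>(- 1) + q\<close>, the \<open>q\<close> coming from \<open>N / t\<close>;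
    \<^item> \<open>p\<close> divides both: \<open>q + (- 1)\<close>, where \<open>N * gcd c t / t\<close> always contributes \<open>q\<close>, which
      \<open>gcd t d / d\<close> removes if \<open>p\<close> does not divide \<open>t\<close>, and the sign of \<open>c\<close> is negative;
    \<^item> \<open>p\<close> divides only \<open>c\<close>: \<open>q + (- q)\<close>;
    \<^item> \<open>p\<close> divides only \<open>d\<close>: \<open>(- 1) + 1\<close>.

  So the product is that of all \<open>p ^ (2 * k) - 1\<close> if \<open>c = d\<close>. Otherwise some prime divides
  exactly one of \<open>c\<close> and \<open>d\<close>, because a divisor of \<open>N\<close> is determined by its primes, and
  the factor at that prime vanishes.
\<close>

text \<open>
  Writing a divisor as a product over one index set, common to all divisors of \<open>N\<close>, allows
  products and quotients of divisors to be combined factor by factor.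
\<close>

lemma prod_primes_dividing_divisor:
  fixes N t :: nat
  assumes "squarefree N" "t dvd N"
  shows "(\<Prod>p\<in>prime_factors N. if p dvd t then p else 1) = t"
proof -
  have "N \<noteq> 0" using assms(1) by (intro notI) simp
  have "squarefree t" using assms squarefree_mono by blast
  then have "t \<noteq> 0" by (intro notI) simp
  have "{p \<in> prime_factors N. p dvd t} = prime_factors t"
    using \<open>N \<noteq> 0\<close> \<open>t \<noteq> 0\<close> assms(2) by (auto simp: in_prime_factors_iff intro: dvd_trans)
  then have "(\<Prod>p\<in>prime_factors N. if p dvd t then p else 1) = \<Prod>(prime_factors t)"
    by (simp flip: prod.inter_filter)
  also have "\<dots> = (\<Prod>p\<in>prime_factors t. p ^ multiplicity p t)"
    using \<open>squarefree t\<close> \<open>t \<noteq> 0\<close> by (intro prod.cong) (auto simp: squarefree_factorial_semiring')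
  also have "\<dots> = t"
    using \<open>t \<noteq> 0\<close> by (simp flip: prime_factorization_nat)
  finally show ?thesis .
qed

lemma of_nat_divisor_eq_prod:
  fixes N t :: nat
  assumes "squarefree N" "t dvd N"
  shows "real t = (\<Prod>p\<in>prime_factors N. if p dvd t then real p else 1)"
  by (subst prod_primes_dividing_divisor[OF assms, symmetric]) (auto intro!: prod.cong)

lemma minus_one_power_omega_eq_prod:
  fixes N t :: nat
  assumes "N \<noteq> 0" "t dvd N"
  shows "(-1 :: real) ^ omega t = (\<Prod>p\<in>prime_factors N. if p dvd t then -1 else 1)"
proof -
  have "{p. prime p \<and> p dvd t} = {p \<in> prime_factors N. p dvd t}"
    using assms by (auto simp: in_prime_factors_iff intro: dvd_trans)
  then show ?thesis
    by (simp add: omega_def flip: prod.inter_filter)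
qed

lemma divisors_squarefree_eqI:
  fixes N c d :: nat
  assumes "squarefree N" "c dvd N" "d dvd N"
    and "\<And>p. p \<in> prime_factors N \<Longrightarrow> p dvd c \<longleftrightarrow> p dvd d"
  shows "c = d"
proof -
  have "(\<Prod>p\<in>prime_factors N. if p dvd c then p else 1)
      = (\<Prod>p\<in>prime_factors N. if p dvd d then p else 1)"
    using assms(4) by (intro prod.cong) auto
  then show ?thesis
    using assms(1-3) by (simp add: prod_primes_dividing_divisor)
qed

text \<open>
  The expansion of \<open>\<Prod>p. (f p + g p)\<close> runs over sets of primes dividing \<open>N\<close>; as \<open>N\<close> is squarefree,
  these are the same as divisors \<open>t\<close> of \<open>N\<close> by taking products and, conversely, the set of
  primes dividing \<open>t\<close>.
\<close>

lemma sum_divisors_squarefree: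
  fixes N :: nat and f g :: "nat \<Rightarrow> 'a :: comm_semiring_1"
  assumes "squarefree N"
  shows "(\<Sum>t | t dvd N. \<Prod>p\<in>prime_factors N. if p dvd t then f p else g p)
       = (\<Prod>p\<in>prime_factors N. f p + g p)"
proof -
  define P where "P = prime_factors N"
  have "N \<noteq> 0" using assms by (intro notI) simp
  have "finite P" by (simp add: P_def)
  have P_prime: "prime p" if "p \<in> P" for p using that by (auto simp: P_def)
  have dvd_prod_iff: "p dvd \<Prod>S \<longleftrightarrow> p \<in> S" if "p \<in> P" "S \<subseteq> P" for p S
  proof -
    have "finite S" using that \<open>finite P\<close> finite_subset by blast
    then have "p dvd \<Prod>S \<longleftrightarrow> (\<exists>q\<in>S. p dvd q)"
      using P_prime that(1) by (simp add: prime_dvd_prod_iff)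
    also have "\<dots> \<longleftrightarrow> p \<in> S"
      using that by (metis P_prime dvd_refl primes_dvd_imp_eq subsetD)
    finally show ?thesis .
  qed
  have prod_P: "\<Prod>P = N"
  proof -
    have "\<Prod>P = (\<Prod>p\<in>prime_factors N. if p dvd N then p else 1)"
      by (auto simp: P_def intro!: prod.cong)
    then show ?thesis using prod_primes_dividing_divisor[OF assms] by simp
  qed
  have "(\<Prod>p\<in>P. f p + g p) = (\<Sum>S\<in>Pow P. prod f S * prod g (P - S))"
    using \<open>finite P\<close> by (rule prod_add)
  also have "\<dots> = (\<Sum>t | t dvd N. \<Prod>p\<in>P. if p dvd t then f p else g p)"
  proof (rule sum.reindex_bij_witness[where i = "\<lambda>t. {p \<in> P. p dvd t}" and j = "\<lambda>S. \<Prod>S"])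
    fix S assume "S \<in> Pow P"
    then have S: "S \<subseteq> P" by simp
    show S_eq: "{p \<in> P. p dvd \<Prod>S} = S" using S dvd_prod_iff by blast
    show "\<Prod>S \<in> {t. t dvd N}"
      using prod_dvd_prod_subset[OF \<open>finite P\<close> S, of "\<lambda>p. p"] prod_P by simp
    have "P \<inter> {p. p dvd \<Prod>S} = S" "P \<inter> - {p. p dvd \<Prod>S} = P - S" using S_eq by blast+
    then show "(\<Prod>p\<in>P. if p dvd \<Prod>S then f p else g p) = prod f S * prod g (P - S)"
      using \<open>finite P\<close> by (simp add: prod.If_cases)
  next
    fix t assume "t \<in> {t. t dvd N}"
    then show "\<Prod>{p \<in> P. p dvd t} = t"
      using prod_primes_dividing_divisor[OF assms, of t] \<open>finite P\<close>
      by (simp add: P_def prod.inter_filter)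
  qed auto
  finally show ?thesis by (simp add: P_def)
qed

theorem lemma3p1:
  fixes N k c d :: nat
  assumes "squarefree N" and "k > 1" and "c dvd N" and "d dvd N"
  shows "(\<Sum>t | t dvd N. (-1) ^ (omega t + omega c) *
            ((real N * real (gcd c t) / real t) * (real (gcd t d) / real d)) ^ (2 * k))
         = (if c = d then (\<Prod>p | prime p \<and> p dvd N. (real p ^ (2 * k) - 1)) else 0)"
proof -
  have "N \<noteq> 0" using assms(1) by (intro notI) simp
  define P where "P = prime_factors N"
  have P_eq: "P = {p. prime p \<and> p dvd N}"
    using \<open>N \<noteq> 0\<close> by (auto simp: P_def in_prime_factors_iff)
  define s where "s p = (if p dvd c then -1 else 1 :: real)" for p
  define e where "e p = (if p dvd d then real p else 1)" for p
  \<comment> \<open>The local terms at \<open>p\<close>: \<open>f\<close> for \<open>t\<close> divisible by \<open>p\<close>, where \<open>N / t\<close> contributes nothing,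
    and \<open>g\<close> for \<open>t\<close> prime to \<open>p\<close>, where both gcds contribute nothing.\<close>
  define f where "f p = - s p * ((if p dvd c then real p else 1) * (e p / e p)) ^ (2 * k)" for p
  define g where "g p = s p * (real p * (1 / e p)) ^ (2 * k)" for p
  have "(-1) ^ (omega t + omega c) *
          ((real N * real (gcd c t) / real t) * (real (gcd t d) / real d)) ^ (2 * k)
      = (\<Prod>p\<in>P. if p dvd t then f p else g p)" if "t dvd N" for t
  proof -
    have "gcd c t dvd N" "gcd t d dvd N" using that by (auto intro: dvd_trans)
    note as_prod = of_nat_divisor_eq_prod[OF assms(1), folded P_def]
      minus_one_power_omega_eq_prod[OF \<open>N \<noteq> 0\<close>, folded P_def]
    have "(-1) ^ (omega t + omega c) *
          ((real N * real (gcd c t) / real t) * (real (gcd t d) / real d)) ^ (2 * k)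
      = (\<Prod>p\<in>P. (if p dvd t then -1 else 1) * (if p dvd c then -1 else 1) *
          (((if p dvd N then real p else 1) * (if p dvd gcd c t then real p else 1)
            / (if p dvd t then real p else 1))
           * ((if p dvd gcd t d then real p else 1) / (if p dvd d then real p else 1))) ^ (2 * k))"
      unfolding power_add as_prod(1)[OF dvd_refl] as_prod(1)[OF \<open>gcd c t dvd N\<close>]
        as_prod(1)[OF \<open>gcd t d dvd N\<close>] as_prod(1)[OF \<open>t dvd N\<close>] as_prod(1)[OF \<open>d dvd N\<close>]
        as_prod(2)[OF \<open>t dvd N\<close>] as_prod(2)[OF \<open>c dvd N\<close>]
      by (simp only: prod.distrib prod_dividef flip: prod_power_distrib)
    also have "\<dots> = (\<Prod>p\<in>P. if p dvd t then f p else g p)"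
      by (intro prod.cong) (auto simp: P_eq f_def g_def s_def e_def)
    finally show ?thesis .
  qed
  then have "(\<Sum>t | t dvd N. (-1) ^ (omega t + omega c) *
            ((real N * real (gcd c t) / real t) * (real (gcd t d) / real d)) ^ (2 * k))
      = (\<Sum>t | t dvd N. \<Prod>p\<in>P. if p dvd t then f p else g p)"
    by (intro sum.cong) auto
  also have "\<dots> = (\<Prod>p\<in>P. f p + g p)"
    unfolding P_def by (rule sum_divisors_squarefree[OF assms(1)])
  also have "\<dots> = (\<Prod>p\<in>P. if p dvd c \<longleftrightarrow> p dvd d then real p ^ (2 * k) - 1 else 0)"
  proof (rule prod.cong)
    fix p assume "p \<in> P"
    then have "real p \<noteq> 0" by (auto simp: P_eq dest: prime_gt_0_nat)
    then show "f p + g p = (if p dvd c \<longleftrightarrow> p dvd d then real p ^ (2 * k) - 1 else 0)"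
      by (simp add: f_def g_def s_def e_def)
  qed simp
  also have "\<dots> = (if c = d then (\<Prod>p\<in>P. real p ^ (2 * k) - 1) else 0)"
  proof (cases "c = d")
    case False
    then obtain p where "p \<in> P" "\<not> (p dvd c \<longleftrightarrow> p dvd d)"
      using divisors_squarefree_eqI[OF assms(1,3,4)] unfolding P_def by blast
    then have "(\<Prod>p\<in>P. if p dvd c \<longleftrightarrow> p dvd d then real p ^ (2 * k) - 1 else 0) = 0"
      by (intro prod_zero) (auto simp: P_def)
    with False show ?thesis by simp
  qed simp
  finally show ?thesis by (simp only: P_eq)
qed

end
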